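(* Let $n\geq 2$ be an integer and let $M$ be an $n$-connected binary matroid with $|E(M)|\geq 2n-2$. Suppose $T\subset E(M)$ with $|T|=n-1$. Then the element splitting matroid $M'_T$ is $n$-connected if and only if $|Q|\geq 2|Q\cap T|$ for every cocircuit $Q$ of $M$ with $Q\cap T\neq\emptyset$.
   Context: Element splitting: let $M$ be a binary matroid with standard matrix representation $A$ over $GF(2)$ and $T\subseteq E(M)$. Let $A'_T$ be the matrix obtained from $A$ by adjoining an extra row whose entries are $1$ in the columns labelled by elements of $T$ and $0$ otherwise, and then adjoining an extra column labelled by a new element $a$ with $1$ in the last row and $0$ elsewhere. $M'_T$ denotes the vector matroid of $A'_T$ (ground set $E(M)\cup\{a\}$). A matroid is $n$-connected (in Tutte's sense) if it has no $k$-separation for any $k<n$, where a $k$-separation of a matroid $N$ with rank function $r$ is a partition $(X,Y)$ of $E(N)$ with $\min\{|X|,|Y|\}\geq k$ and $r(X)+r(Y)-r(E(N))\leq k-1$. *)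

theory Defs
  imports Complex_Main "HOL-Library.Z2" "HOL-Library.Function_Algebras"
begin

section \<open>Matroids\<close>

record 'a matroid =
  ground :: "'a set"
  indep :: "'a set set"

locale matroid =
  fixes M :: "'a matroid" (structure)
  assumes finite_ground: "finite (ground M)"
    and indep_subset: "X \<in> indep M \<Longrightarrow> X \<subseteq> ground M"
    and indep_empty: "{} \<in> indep M"
    and indep_mono: "X \<in> indep M \<Longrightarrow> Y \<subseteq> X \<Longrightarrow> Y \<in> indep M"
    and indep_augment: "X \<in> indep M \<Longrightarrow> Y \<in> indep M \<Longrightarrow> card X < card Y \<Longrightarrow>
      \<exists>y\<in>Y - X. insert y X \<in> indep M"

definition rank_of :: "'a matroid \<Rightarrow> 'a set \<Rightarrow> nat" where
  "rank_of M X = Max (card ` {I \<in> indep M. I \<subseteq> X})"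

definition basis :: "'a matroid \<Rightarrow> 'a set \<Rightarrow> bool" where
  "basis M B \<longleftrightarrow> B \<in> indep M \<and> (\<forall>I\<in>indep M. B \<subseteq> I \<longrightarrow> I = B)"

definition circuit :: "'a matroid \<Rightarrow> 'a set \<Rightarrow> bool" where
  "circuit M C \<longleftrightarrow> C \<subseteq> ground M \<and> C \<notin> indep M \<and> (\<forall>D. D \<subset> C \<longrightarrow> D \<in> indep M)"

definition dual :: "'a matroid \<Rightarrow> 'a matroid" where
  "dual M = \<lparr>ground = ground M, indep = {X. \<exists>B. basis M B \<and> X \<subseteq> ground M - B}\<rparr>"

definition cocircuit :: "'a matroid \<Rightarrow> 'a set \<Rightarrow> bool" where
  "cocircuit M Q \<longleftrightarrow> circuit (dual M) Q"

text \<open>The connectivity function is taken over \<^typ>\<open>int\<close>, so that neither subtraction is truncated.\<close>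

definition k_separation :: "nat \<Rightarrow> 'a matroid \<Rightarrow> 'a set \<Rightarrow> 'a set \<Rightarrow> bool" where
  "k_separation k N X Y \<longleftrightarrow>
     X \<union> Y = ground N \<and> X \<inter> Y = {} \<and> min (card X) (card Y) \<ge> k \<and>
     int (rank_of N X) + int (rank_of N Y) - int (rank_of N (ground N)) \<le> int k - 1"

definition n_connected :: "nat \<Rightarrow> 'a matroid \<Rightarrow> bool" where
  "n_connected n N \<longleftrightarrow> (\<forall>k<n. \<nexists>X Y. k_separation k N X Y)"


section \<open>Matrices over GF(2) and their vector matroids\<close>

text \<open>
  The rows of a matrix are numbered \<open>0, \<dots>, row_count - 1\<close> and its columns are labelled by the
  elements of \<open>labels\<close>. The values of \<open>entry\<close> outside this range are irrelevant.
\<close>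

record 'a gf2_matrix =
  row_count :: nat
  labels :: "'a set"
  entry :: "nat \<Rightarrow> 'a \<Rightarrow> bit"

text \<open>Column vectors live in the space of all functions from \<^typ>\<open>nat\<close> to GF(2), padded with zeros.\<close>

definition column :: "'a gf2_matrix \<Rightarrow> 'a \<Rightarrow> nat \<Rightarrow> bit" where
  "column A e = (\<lambda>i. if i < row_count A then entry A i e else 0)"

definition gf2_scale :: "bit \<Rightarrow> (nat \<Rightarrow> bit) \<Rightarrow> nat \<Rightarrow> bit" where
  "gf2_scale c v = (\<lambda>i. c * v i)"

interpretation gf2: vector_space gf2_scale
  by unfold_locales (auto simp: gf2_scale_def fun_eq_iff algebra_simps simp del: minus_bit_def)

text \<open>
  Injectivity of \<^const>\<open>column\<close> makes linear independence refer to the family of columns: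
  two elements labelling equal columns are parallel.
\<close>

definition vector_matroid :: "'a gf2_matrix \<Rightarrow> 'a matroid" where
  "vector_matroid A = \<lparr>ground = labels A,
     indep = {X. X \<subseteq> labels A \<and> inj_on (column A) X \<and> gf2.independent (column A ` X)}\<rparr>"

lemma matroid_vector_matroid:
  assumes "finite (labels A)"
  shows "matroid (vector_matroid A)"
proof
  fix X Y
  assume X: "X \<in> indep (vector_matroid A)" and Y: "Y \<in> indep (vector_matroid A)"
    and less: "card X < card Y"
  let ?c = "column A"
  from X Y have sub: "X \<subseteq> labels A" "Y \<subseteq> labels A" and inj: "inj_on ?c X" "inj_on ?c Y"
    and ind: "gf2.independent (?c ` X)" "gf2.independent (?c ` Y)"
    by (auto simp: vector_matroid_def)
  have "finite X"
    using sub assms finite_subset by blast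
  have "\<not> ?c ` Y \<subseteq> gf2.span (?c ` X)"
  proof
    assume "?c ` Y \<subseteq> gf2.span (?c ` X)"
    then have "card (?c ` Y) \<le> card (?c ` X)"
      using gf2.independent_span_bound[OF _ ind(2)] \<open>finite X\<close> by blast
    with less inj show False
      by (simp add: card_image)
  qed
  then obtain y where y: "y \<in> Y" "?c y \<notin> gf2.span (?c ` X)"
    by blast
  then have "?c y \<notin> ?c ` X"
    using gf2.span_base by blast
  moreover from this have "y \<notin> X"
    by blast
  moreover have "gf2.independent (?c ` insert y X)"
    using gf2.independent_insertI[OF y(2) ind(1)] by simp
  ultimately have "insert y X \<in> indep (vector_matroid A)"
    using y(1) sub inj(1) by (auto simp: vector_matroid_def)
  with y(1) \<open>y \<notin> X\<close> show "\<exists>y\<in>Y - X. insert y X \<in> indep (vector_matroid A)"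
    by blast
next
  fix X Y
  assume "X \<in> indep (vector_matroid A)" "Y \<subseteq> X"
  then show "Y \<in> indep (vector_matroid A)"
    using gf2.dependent_mono[of "column A ` Y" "column A ` X"]
    by (auto simp: vector_matroid_def intro: inj_on_subset)
qed (use assms gf2.independent_empty in \<open>auto simp: vector_matroid_def\<close>)

definition binary_matroid :: "'a matroid \<Rightarrow> bool" where
  "binary_matroid M \<longleftrightarrow> matroid M \<and> (\<exists>A. vector_matroid A = M)"

text \<open>
  A standard matrix has the form \<open>[I | D]\<close> up to the order of its columns, which carries no
  information as the columns are labelled; \<open>b i\<close> is the label of the \<open>i\<close>-th column of the identity.
\<close>

definition standard_matrix :: "'a gf2_matrix \<Rightarrow> bool" where
  "standard_matrix A \<longleftrightarrow> (\<exists>b. (\<forall>j<row_count A. b j \<in> labels A) \<and>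
     (\<forall>i<row_count A. \<forall>j<row_count A. entry A i (b j) = (if i = j then 1 else 0)))"

definition standard_representation :: "'a gf2_matrix \<Rightarrow> 'a matroid \<Rightarrow> bool" where
  "standard_representation A M \<longleftrightarrow> standard_matrix A \<and> vector_matroid A = M"


section \<open>Element splitting\<close>

definition element_splitting_matrix :: "'a gf2_matrix \<Rightarrow> 'a set \<Rightarrow> 'a \<Rightarrow> 'a gf2_matrix" where
  "element_splitting_matrix A T a =
     \<lparr>row_count = Suc (row_count A),
      labels = insert a (labels A),
      entry = (\<lambda>i e. if i < row_count A then (if e = a then 0 else entry A i e)
                     else (if e \<in> T \<or> e = a then 1 else 0))\<rparr>"

definition element_splitting :: "'a gf2_matrix \<Rightarrow> 'a set \<Rightarrow> 'a \<Rightarrow> 'a matroid" where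
  "element_splitting A T a = vector_matroid (element_splitting_matrix A T a)"

end

theory Submission
  imports Defs
begin

text \<open>
  Call \<open>Z\<close> a cocycle if it is the support of a linear functional on the columns. Contracting \<open>a\<close>
  gives \<open>M\<close> back, and the rank of \<open>X \<subseteq> E(M)\<close> stays the same under splitting iff some cocycle agrees
  with \<open>T\<close> on \<open>X\<close>. As \<open>M\<close> is \<open>n\<close>-connected, the only way for the splitting to have a
  \<open>k\<close>-separation with \<open>k < n\<close> is that \<open>a\<close> lies on a side \<open>Y \<union> {a}\<close> with \<open>|Y| = k - 1\<close> whose
  complement \<open>X\<close> has unchanged rank. So the splitting is \<open>n\<close>-connected iff no cocycle \<open>Z\<close> differs
  from \<open>T\<close> in at most \<open>n - 2\<close> elements, i.e. iff \<open>|Z| \<ge> 2 |Z \<inter> T|\<close> for all cocycles. Since cocycles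
  are disjoint unions of cocircuits, it suffices to know this for cocircuits.
\<close>

section \<open>Linear relations and linear functionals over GF(2)\<close>

declare add_bit_eq_xor [simp del] mult_bit_eq_and [simp del] minus_bit_def [simp del]

lemma sum_fun_apply: "(\<Sum>x\<in>D. g x) i = (\<Sum>x\<in>D. g x i)" for g :: "'a \<Rightarrow> 'b \<Rightarrow> 'c::comm_monoid_add"
  by (induction D rule: infinite_finite_induct) auto

lemma bit_add_self: "x + x = 0" for x :: bit
  by (cases x) auto

lemma gf2_fun_add_self: "v + v = 0" for v :: "nat \<Rightarrow> bit"
  by (simp add: fun_eq_iff bit_add_self)

text \<open>The second space is GF(2) acting on itself by multiplication, so the linear maps of this
  pair are the linear functionals on column vectors.\<close>

interpretation gf2_functional: vector_space_pair gf2_scale "(*) :: bit \<Rightarrow> bit \<Rightarrow> bit"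
  by unfold_locales (auto simp: algebra_simps)

abbreviation gf2_functional :: "((nat \<Rightarrow> bit) \<Rightarrow> bit) \<Rightarrow> bool" where
  "gf2_functional \<equiv> Vector_Spaces.linear gf2_scale (*)"

text \<open>Coefficients in GF(2) are 0 or 1, so a linear relation is a subset with zero sum. Two
  labels with equal columns form such a subset, which is why injectivity is covered as well.\<close>

lemma gf2_independent_family_iff:
  assumes "finite X"
  shows "inj_on c X \<and> gf2.independent (c ` X) \<longleftrightarrow> (\<forall>D\<subseteq>X. D \<noteq> {} \<longrightarrow> (\<Sum>e\<in>D. c e) \<noteq> 0)"
proof (intro iffI allI impI notI)
  fix D
  assume c: "inj_on c X \<and> gf2.independent (c ` X)" and D: "D \<subseteq> X" "D \<noteq> {}" "(\<Sum>e\<in>D. c e) = 0"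
  let ?u = "\<lambda>v. if v \<in> c ` D then 1 else 0 :: bit"
  have "(\<Sum>v\<in>c ` X. gf2_scale (?u v) v) = (\<Sum>v\<in>c ` D. v)"
    using assms D(1) by (intro sum.mono_neutral_cong_right) (auto simp: gf2_scale_def fun_eq_iff)
  also have "\<dots> = 0"
    using D c inj_on_subset by (subst sum.reindex) fastforce+
  finally have "gf2.dependent (c ` X)"
    using assms D(1,2) by (subst gf2.dependent_finite) (auto intro!: exI[of _ ?u] bexI)
  with c show False by blast
next
  assume nz: "\<forall>D\<subseteq>X. D \<noteq> {} \<longrightarrow> (\<Sum>e\<in>D. c e) \<noteq> 0"
  have inj: "inj_on c X"
  proof (rule inj_onI, rule ccontr)
    fix x y assume "x \<in> X" "y \<in> X" "c x = c y" "x \<noteq> y"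
    then show False
      using nz[rule_format, of "{x, y}"] by (simp add: gf2_fun_add_self)
  qed
  moreover have "gf2.independent (c ` X)"
  proof
    assume "gf2.dependent (c ` X)"
    then obtain u v where u: "v \<in> c ` X" "u v \<noteq> 0" "(\<Sum>v\<in>c ` X. gf2_scale (u v) v) = 0"
      using assms by (auto simp: gf2.dependent_finite)
    \<comment> \<open>Every nonzero coefficient equals 1, so the support of \<open>u\<close>, pulled
      back to labels, has zero sum.\<close>
    let ?D = "{e \<in> X. u (c e) \<noteq> 0}"
    have "(\<Sum>e\<in>?D. c e) = (\<Sum>e\<in>X. gf2_scale (u (c e)) (c e))"
      using assms by (intro sum.mono_neutral_cong_left) (auto simp: gf2_scale_def fun_eq_iff)
    also have "\<dots> = 0"
      using u(3) inj by (simp add: sum.reindex)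
    finally show False
      using nz[rule_format, of ?D] u(1,2) by auto
  qed
  ultimately show "inj_on c X \<and> gf2.independent (c ` X)" ..
qed

lemma indep_vector_matroid_iff:
  assumes "finite (labels A)"
  shows "X \<in> indep (vector_matroid A) \<longleftrightarrow>
    X \<subseteq> labels A \<and> (\<forall>D\<subseteq>X. D \<noteq> {} \<longrightarrow> (\<Sum>e\<in>D. column A e) \<noteq> 0)"
  using gf2_independent_family_iff[of X "column A"] assms finite_subset
  by (auto simp: vector_matroid_def)

lemma indep_vector_matroid_sum_0D:
  assumes "finite (labels A)" "X \<in> indep (vector_matroid A)" "D \<subseteq> X" "(\<Sum>e\<in>D. column A e) = 0"
  shows "D = {}"
  using assms(2,3,4) unfolding indep_vector_matroid_iff[OF assms(1)] by metis

lemma ground_vector_matroid [simp]: "ground (vector_matroid A) = labels A"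
  by (simp add: vector_matroid_def)

lemma gf2_functional_sum:
  "gf2_functional f \<Longrightarrow> f (\<Sum>e\<in>D. c e) = (\<Sum>e\<in>D. f (c e))"
  by (rule gf2_functional.linear_sum)

text \<open>Values are prescribed on labels but a functional takes vectors; injectivity of
  \<open>column A\<close> on \<open>I\<close> lets \<open>the_inv_into\<close> translate before the
  linear extension.\<close>

lemma gf2_functional_extend_indep:
  assumes "I \<in> indep (vector_matroid A)"
  obtains f where "gf2_functional f" "\<And>e. e \<in> I \<Longrightarrow> f (column A e) = h e"
proof -
  have inj: "inj_on (column A) I" and "gf2.independent (column A ` I)"
    using assms by (auto simp: vector_matroid_def)
  then obtain f where "gf2_functional f"
    "\<forall>v\<in>column A ` I. f v = (h \<circ> the_inv_into I (column A)) v"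
    using gf2_functional.linear_independent_extend by blast
  with inj show ?thesis
    by (intro that[of f]) (auto simp: the_inv_into_f_f)
qed

section \<open>Rank, bases and cocircuits of a matroid\<close>

context matroid
begin

lemma finite_indep: "X \<in> indep M \<Longrightarrow> finite X"
  using finite_ground indep_subset finite_subset by blast

lemma finite_indep_cards: "finite (card ` {I \<in> indep M. I \<subseteq> X})"
proof -
  have "{I \<in> indep M. I \<subseteq> X} \<subseteq> Pow (ground M)"
    using indep_subset by blast
  then show ?thesis
    using finite_ground finite_subset by blast
qed

lemma card_le_rank: "I \<in> indep M \<Longrightarrow> I \<subseteq> X \<Longrightarrow> card I \<le> rank_of M X"
  using finite_indep_cards by (auto simp: rank_of_def intro: Max_ge)

lemma rank_witness:
  obtains I where "I \<in> indep M" "I \<subseteq> X" "card I = rank_of M X"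
proof -
  have "rank_of M X \<in> card ` {I \<in> indep M. I \<subseteq> X}"
    unfolding rank_of_def using finite_indep_cards indep_empty by (intro Max_in) auto
  then show ?thesis using that by auto
qed

lemma rank_le_card: "finite X \<Longrightarrow> rank_of M X \<le> card X"
  by (rule rank_witness[of X]) (metis card_mono)

lemma extend_to_rank:
  assumes "I \<in> indep M" "I \<subseteq> X"
  obtains J where "J \<in> indep M" "I \<subseteq> J" "J \<subseteq> X" "card J = rank_of M X"
proof -
  define P where "P = (\<lambda>J. J \<in> indep M \<and> I \<subseteq> J \<and> J \<subseteq> X)"
  have "P I" "\<forall>J. P J \<longrightarrow> card J \<le> rank_of M X"
    using assms card_le_rank by (auto simp: P_def)
  \<comment> \<open>The greatest-element principle asks for a strict bound, hence the
    \<open>Suc\<close>.\<close>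
  then obtain J where J: "P J" and max: "\<And>J'. P J' \<Longrightarrow> card J' \<le> card J"
    using ex_has_greatest_nat[of P I card "Suc (rank_of M X)"] le_imp_less_Suc by blast
  have "\<not> card J < rank_of M X"
  proof
    assume less: "card J < rank_of M X"
    obtain K where K: "K \<in> indep M" "K \<subseteq> X" "card K = rank_of M X"
      by (rule rank_witness)
    then obtain y where y: "y \<in> K - J" "insert y J \<in> indep M"
      using indep_augment[of J K] J less by (auto simp: P_def)
    then have "P (insert y J)"
      using J K by (auto simp: P_def)
    with max y finite_indep[of J] J show False
      by (fastforce simp: P_def)
  qed
  moreover from J have "J \<in> indep M" "I \<subseteq> J" "J \<subseteq> X"
    by (auto simp: P_def)
  ultimately show ?thesis
    using that[of J] card_le_rank[of J X] by linarith
qed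

lemma basis_exists: obtains B where "basis M B"
proof -
  obtain B where B: "B \<in> indep M" "card B = rank_of M (ground M)"
    by (rule rank_witness)
  have "I = B" if "I \<in> indep M" "B \<subseteq> I" for I
    using card_seteq[OF finite_indep[OF that(1)] that(2)] card_le_rank[OF that(1)] B
      indep_subset[OF that(1)] by simp
  with B(1) have "basis M B" by (auto simp: basis_def)
  then show ?thesis by (rule that)
qed

text \<open>An independent set properly containing \<open>I\<close> would be larger than
  \<open>B\<close> and hence augment \<open>B\<close>, against maximality. This will recognise the
  result of a basis exchange.\<close>

lemma basis_of_card_eq:
  assumes "basis M B" "I \<in> indep M" "card I = card B"
  shows "basis M I"
proof -
  have "J = I" if J: "J \<in> indep M" "I \<subseteq> J" for J
  proof (rule ccontr)
    assume "J \<noteq> I"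
    then have "card B < card J"
      using J assms(3) psubset_card_mono[OF finite_indep[OF J(1)], of I] by auto
    then obtain y where "y \<in> J - B" "insert y B \<in> indep M"
      using indep_augment[of B J] assms(1) J(1) by (auto simp: basis_def)
    with assms(1) show False by (auto simp: basis_def)
  qed
  with assms(2) show ?thesis by (auto simp: basis_def)
qed

text \<open>A subset of the ground set is independent in the dual iff some basis avoids it, so
  cocircuits are the minimal sets that meet every basis. All later arguments use this form.\<close>

lemma cocircuit_iff:
  "cocircuit M Q \<longleftrightarrow> Q \<subseteq> ground M \<and> (\<forall>B. basis M B \<longrightarrow> B \<inter> Q \<noteq> {}) \<and>
    (\<forall>D. D \<subset> Q \<longrightarrow> (\<exists>B. basis M B \<and> B \<inter> D = {}))"
proof -
  have coindep: "X \<in> indep (dual M) \<longleftrightarrow> (\<exists>B. basis M B \<and> B \<inter> X = {})" if "X \<subseteq> ground M" for X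
    using that by (auto simp: dual_def)
  have ground: "ground (dual M) = ground M"
    by (simp add: dual_def)
  show ?thesis
  proof (cases "Q \<subseteq> ground M")
    case True
    then have "D \<in> indep (dual M) \<longleftrightarrow> (\<exists>B. basis M B \<and> B \<inter> D = {})" if "D \<subset> Q" for D
      using that by (intro coindep) auto
    then show ?thesis
      unfolding cocircuit_def circuit_def ground using True coindep[OF True] by simp
  qed (simp add: cocircuit_def circuit_def ground)
qed

lemma cocircuit_nonempty:
  assumes "cocircuit M Q"
  shows "Q \<noteq> {}"
proof -
  obtain B where "basis M B" by (rule basis_exists)
  with assms show ?thesis by (auto simp: cocircuit_iff)
qed

lemma cocircuit_within:
  assumes "Z \<subseteq> ground M" "\<And>B. basis M B \<Longrightarrow> B \<inter> Z \<noteq> {}"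
  obtains Q where "cocircuit M Q" "Q \<subseteq> Z"
proof -
  define P where "P = (\<lambda>D. D \<subseteq> Z \<and> (\<forall>B. basis M B \<longrightarrow> B \<inter> D \<noteq> {}))"
  have "P Z" using assms(2) by (simp add: P_def)
  then obtain Q where Q: "P Q" and min: "\<And>D. P D \<Longrightarrow> card Q \<le> card D"
    using ex_has_least_nat[of P Z card] by blast
  have "\<exists>B. basis M B \<and> B \<inter> D = {}" if "D \<subset> Q" for D
  proof -
    have "finite Q"
      using Q assms(1) finite_ground finite_subset by (metis P_def)
    then have "card D < card Q"
      using that by (rule psubset_card_mono)
    then have "\<not> P D" using min leD by blast
    with that Q show ?thesis by (auto simp: P_def)
  qed
  with Q assms(1) have "cocircuit M Q"
    unfolding cocircuit_iff P_def by blast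
  then show ?thesis
    by (rule that) (use Q in \<open>simp add: P_def\<close>)
qed

end

section \<open>Cocycles and their decomposition into cocircuits\<close>

text \<open>These are the supports of the vectors in the row space of \<open>A\<close>, the empty
  set included. Functionals are used instead of row combinations because they can be prescribed on
  an independent set.\<close>

definition cocycle :: "'a gf2_matrix \<Rightarrow> 'a set \<Rightarrow> bool" where
  "cocycle A Z \<longleftrightarrow> (\<exists>f. gf2_functional f \<and> Z = {e \<in> labels A. f (column A e) = 1})"

lemma cocycle_subset: "cocycle A Z \<Longrightarrow> Z \<subseteq> labels A"
  by (auto simp: cocycle_def)

lemma cocycle_sym_diff:
  assumes "cocycle A Y" "cocycle A Z"
  shows "cocycle A (sym_diff Y Z)"
proof -
  obtain f g where "gf2_functional f" "Y = {e \<in> labels A. f (column A e) = 1}"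
    "gf2_functional g" "Z = {e \<in> labels A. g (column A e) = 1}"
    using assms by (auto simp: cocycle_def)
  then show ?thesis
    unfolding cocycle_def
    by (intro exI[of _ "\<lambda>v. f v + g v"])
      (auto intro: gf2_functional.linear_compose_add)
qed

text \<open>A functional vanishing on the columns of a basis vanishes on all columns, because each
  column is a sum of basis columns.\<close>

lemma cocycle_meets_basis:
  assumes "finite (labels A)" "cocycle A Z" "Z \<noteq> {}" "basis (vector_matroid A) B"
  shows "B \<inter> Z \<noteq> {}"
proof
  assume disj: "B \<inter> Z = {}"
  obtain f where f: "gf2_functional f" and Z: "Z = {e \<in> labels A. f (column A e) = 1}"
    using assms(2) by (auto simp: cocycle_def)
  obtain e where e: "e \<in> labels A" "f (column A e) = 1"
    using assms(3) Z by blast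
  have B: "B \<in> indep (vector_matroid A)" "B \<subseteq> labels A"
    using assms(4) by (auto simp: basis_def vector_matroid_def)
  have fB: "f (column A x) = 0" if "x \<in> B" for x
    using that disj B(2) Z by (auto simp: disjoint_iff)
  with e have "e \<notin> B" by auto
  then have "insert e B \<notin> indep (vector_matroid A)"
    using assms(4) by (auto simp: basis_def)
  then obtain D where D: "D \<subseteq> insert e B" "D \<noteq> {}" "(\<Sum>x\<in>D. column A x) = 0"
    using B(2) e(1) by (auto simp: indep_vector_matroid_iff[OF assms(1)])
  \<comment> \<open>Otherwise \<open>D\<close> would be a relation inside \<open>B\<close>. Applying
    \<open>f\<close> to the relation now leaves only the term at \<open>e\<close>, which is
    1.\<close>
  have "e \<in> D"
    using indep_vector_matroid_sum_0D[OF assms(1) B(1) _ D(3)] D(1,2) by blast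
  have "finite D"
    using D(1) B(2) assms(1) by (meson finite.insertI finite_subset)
  have "(\<Sum>x\<in>D. f (column A x)) = (\<Sum>x\<in>{e}. f (column A x))"
    using \<open>finite D\<close> \<open>e \<in> D\<close> D(1) fB by (intro sum.mono_neutral_right) auto
  moreover have "(\<Sum>x\<in>D. f (column A x)) = 0"
    using gf2_functional_sum[OF f, of "column A" D] D(3) gf2_functional.linear_0[OF f] by simp
  ultimately show False using e(2) by simp
qed

text \<open>This is the fundamental cocircuit construction. By minimality of \<open>Q\<close> some
  basis \<open>B\<close> meets it in a single element \<open>e\<close>; the functional that is 1 at
  \<open>e\<close> and 0 on the rest of \<open>B\<close> turns out to have support
  \<open>Q\<close>.\<close>

lemma cocircuit_imp_cocycle:
  assumes "finite (labels A)" "cocircuit (vector_matroid A) Q"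
  shows "cocycle A Q"
proof -
  interpret matroid "vector_matroid A"
    using assms(1) by (rule matroid_vector_matroid)
  note ind = indep_vector_matroid_iff[OF assms(1)]
  have Q: "Q \<subseteq> labels A" "\<And>B. basis (vector_matroid A) B \<Longrightarrow> B \<inter> Q \<noteq> {}"
    and min: "\<And>D. D \<subset> Q \<Longrightarrow> \<exists>B. basis (vector_matroid A) B \<and> B \<inter> D = {}"
    using assms(2) by (auto simp: cocircuit_iff)
  obtain e where "e \<in> Q"
    using cocircuit_nonempty[OF assms(2)] by blast
  then obtain B where B: "basis (vector_matroid A) B" "B \<inter> (Q - {e}) = {}"
    using min[of "Q - {e}"] by blast
  then have BQ: "B \<inter> Q = {e}" using Q(2) by blast
  have Bind: "B \<in> indep (vector_matroid A)" using B(1) by (simp add: basis_def)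
  then obtain f where f: "gf2_functional f"
    and fB: "\<And>x. x \<in> B \<Longrightarrow> f (column A x) = (if x = e then 1 else 0)"
    using gf2_functional_extend_indep[of B A "\<lambda>x. if x = e then 1 else 0"] by blast
  let ?Z = "{x \<in> labels A. f (column A x) = 1}"
  have Z: "cocycle A ?Z" using f by (auto simp: cocycle_def)
  have "e \<in> ?Z" using BQ Q(1) fB[of e] by auto
  have "?Z \<subseteq> Q"
  proof (rule ccontr)
    assume "\<not> ?Z \<subseteq> Q"
    then obtain x where x: "x \<in> labels A" "f (column A x) = 1" "x \<notin> Q" by blast
    with fB[of x] \<open>e \<in> Q\<close> have "x \<notin> B" by (auto split: if_splits)
    \<comment> \<open>Exchanging \<open>e\<close> for \<open>x\<close> gives a basis that avoids
      \<open>Q\<close>, which is impossible. It is independent because a relation must involve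
      \<open>x\<close>, and \<open>f\<close> is 1 at \<open>x\<close> but 0 on
      \<open>B - {e}\<close>.\<close>
    let ?B = "insert x (B - {e})"
    have "(\<Sum>y\<in>D. column A y) \<noteq> 0" if D: "D \<subseteq> ?B" "D \<noteq> {}" for D
    proof
      assume zero: "(\<Sum>y\<in>D. column A y) = 0"
      then have "x \<in> D"
        using indep_vector_matroid_sum_0D[OF assms(1) Bind _ zero] D by blast
      have "finite D"
        using D(1) finite_indep[OF Bind] by (meson finite.insertI finite_Diff finite_subset)
      have "(\<Sum>y\<in>D. f (column A y)) = (\<Sum>y\<in>{x}. f (column A y))"
      proof (rule sum.mono_neutral_right)
        show "\<forall>y\<in>D - {x}. f (column A y) = 0"
        proof
          fix y assume "y \<in> D - {x}"
          then have "y \<in> B" "y \<noteq> e" using D(1) by auto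
          then show "f (column A y) = 0" using fB[of y] by simp
        qed
      qed (use \<open>finite D\<close> \<open>x \<in> D\<close> in auto)
      moreover have "(\<Sum>y\<in>D. f (column A y)) = 0"
        using gf2_functional_sum[OF f, of "column A" D] zero gf2_functional.linear_0[OF f] by simp
      ultimately show False using x(2) by simp
    qed
    then have "?B \<in> indep (vector_matroid A)"
      using x(1) Bind unfolding ind by blast
    moreover have "card ?B = card B"
    proof -
      have "e \<in> B" using BQ by blast
      have "card ?B = Suc (card (B - {e}))"
        using \<open>x \<notin> B\<close> finite_indep[OF Bind] by (intro card_insert_disjoint) auto
      also have "\<dots> = card B"
        using finite_indep[OF Bind] \<open>e \<in> B\<close> by (rule card_Suc_Diff1)
      finally show ?thesis .
    qed
    ultimately have "basis (vector_matroid A) ?B"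
      using basis_of_card_eq B(1) by blast
    with Q(2)[of ?B] BQ x(3) show False by blast
  qed
  \<comment> \<open>A proper subset of \<open>Q\<close> misses some basis, while a nonempty cocycle
    meets every basis.\<close>
  moreover have "\<not> ?Z \<subset> Q"
    using min[of ?Z] cocycle_meets_basis[OF assms(1) Z] \<open>e \<in> ?Z\<close> by blast
  ultimately have "?Z = Q" by blast
  with Z show ?thesis by simp
qed

text \<open>A nonempty cocycle contains a cocircuit \<open>Q\<close>, and \<open>Z - Q\<close> is
  again a cocycle, being a symmetric difference of two. Both sides of the bound are additive over
  \<open>Q\<close> and \<open>Z - Q\<close>, so induction on the size applies.\<close>

lemma cocycle_bound_of_cocircuit_bound:
  assumes fin: "finite (labels A)"
    and bound: "\<And>Q. cocircuit (vector_matroid A) Q \<Longrightarrow> 2 * card (Q \<inter> T) \<le> card Q"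
    and "cocycle A Z"
  shows "2 * card (Z \<inter> T) \<le> card Z"
  using assms(3)
proof (induction "card Z" arbitrary: Z rule: less_induct)
  case less
  interpret matroid "vector_matroid A"
    using fin by (rule matroid_vector_matroid)
  have finZ: "finite Z"
    using cocycle_subset[OF less.prems] fin finite_subset by blast
  show ?case
  proof (cases "Z = {}")
    case False
    obtain Q where Q: "cocircuit (vector_matroid A) Q" "Q \<subseteq> Z"
    proof (rule cocircuit_within)
      show "Z \<subseteq> ground (vector_matroid A)"
        using cocycle_subset[OF less.prems] by simp
      show "B \<inter> Z \<noteq> {}" if "basis (vector_matroid A) B" for B
        using cocycle_meets_basis[OF fin less.prems False that] .
    qed
    have "Q \<noteq> {}"
      using Q(1) by (rule cocircuit_nonempty)
    have "sym_diff Z Q = Z - Q" using Q(2) by blast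
    then have "cocycle A (Z - Q)"
      using cocycle_sym_diff[OF less.prems cocircuit_imp_cocycle[OF fin Q(1)]] by simp
    moreover have "card (Z - Q) < card Z"
      using finZ Q(2) \<open>Q \<noteq> {}\<close> by (intro psubset_card_mono) auto
    ultimately have "2 * card ((Z - Q) \<inter> T) \<le> card (Z - Q)"
      using less.hyps by blast
    moreover have "card Z = card Q + card (Z - Q)"
      using finZ Q(2) by (metis card_Diff_subset card_mono finite_subset le_add_diff_inverse)
    moreover have "card (Z \<inter> T) = card (Q \<inter> T) + card ((Z - Q) \<inter> T)"
    proof -
      have "Z \<inter> T = (Q \<inter> T) \<union> ((Z - Q) \<inter> T)" using Q(2) by blast
      moreover have "(Q \<inter> T) \<inter> ((Z - Q) \<inter> T) = {}" by blast
      ultimately show ?thesis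
        using finZ Q(2) finite_subset by (metis card_Un_disjoint finite_Diff finite_Int)
    qed
    ultimately show ?thesis using bound[OF Q(1)] by linarith
  qed simp
qed

text \<open>After cancelling \<open>T - Z\<close> on the left and one copy of the intersection on
  the right, both inequalities say that \<open>Z \<inter> T\<close> is at most as large as
  \<open>Z - T\<close>.\<close>

lemma card_sym_diff_ge_iff:
  assumes "finite T" "finite Z"
  shows "card T \<le> card (sym_diff T Z) \<longleftrightarrow> 2 * card (Z \<inter> T) \<le> card Z"
proof -
  have "card (sym_diff T Z) = card (T - Z) + card (Z - T)"
    using assms by (intro card_Un_disjoint) auto
  moreover have "card T = card (T - Z) + card (Z \<inter> T)"
    using assms by (metis Int_commute add.commute card_Int_Diff)
  moreover have "card Z = card (Z - T) + card (Z \<inter> T)"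
    using assms by (metis add.commute card_Int_Diff)
  ultimately show ?thesis by linarith
qed

lemma cocircuit_bound_iff_cocycle_distance:
  assumes "finite (labels A)" "finite T"
  shows "(\<forall>Q. cocircuit (vector_matroid A) Q \<and> Q \<inter> T \<noteq> {} \<longrightarrow> 2 * card (Q \<inter> T) \<le> card Q) \<longleftrightarrow>
    (\<forall>Z. cocycle A Z \<longrightarrow> card T \<le> card (sym_diff T Z))"
proof -
  have "(\<forall>Q. cocircuit (vector_matroid A) Q \<and> Q \<inter> T \<noteq> {} \<longrightarrow> 2 * card (Q \<inter> T) \<le> card Q) \<longleftrightarrow>
    (\<forall>Q. cocircuit (vector_matroid A) Q \<longrightarrow> 2 * card (Q \<inter> T) \<le> card Q)"
    by fastforce
  also have "\<dots> \<longleftrightarrow> (\<forall>Z. cocycle A Z \<longrightarrow> 2 * card (Z \<inter> T) \<le> card Z)"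
    using cocycle_bound_of_cocircuit_bound[OF assms(1)] cocircuit_imp_cocycle[OF assms(1)] by blast
  also have "\<dots> \<longleftrightarrow> (\<forall>Z. cocycle A Z \<longrightarrow> card T \<le> card (sym_diff T Z))"
    using card_sym_diff_ge_iff[OF assms(2)] cocycle_subset assms(1) finite_subset by metis
  finally show ?thesis .
qed

section \<open>Independence and rank in the splitting matroid\<close>

locale splitting =
  fixes A :: "'a gf2_matrix" and T :: "'a set" and a :: 'a
  assumes finite_labels: "finite (labels A)"
    and a_new: "a \<notin> labels A"
    and T_subset: "T \<subseteq> labels A"
begin

abbreviation "M \<equiv> vector_matroid A"
abbreviation "N \<equiv> element_splitting A T a"

sublocale M: matroid M
  using finite_labels by (rule matroid_vector_matroid)

lemma finite_split_labels: "finite (labels (element_splitting_matrix A T a))"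
  using finite_labels by (simp add: element_splitting_matrix_def)

sublocale N: matroid N
  unfolding element_splitting_def using finite_split_labels by (rule matroid_vector_matroid)

lemma ground_N: "ground N = insert a (labels A)"
  by (simp add: element_splitting_def element_splitting_matrix_def)

text \<open>The old rows give the sum over \<open>D - {a}\<close>, since the column of
  \<open>a\<close> is zero there; the new row gives the parity of the number of elements of
  \<open>D\<close> in \<open>T\<close> or equal to \<open>a\<close>.\<close>

lemma split_sum_eq_0_iff:
  assumes "D \<subseteq> insert a (labels A)"
  shows "(\<Sum>e\<in>D. column (element_splitting_matrix A T a) e) = 0 \<longleftrightarrow>
    (\<Sum>e\<in>D - {a}. column A e) = 0 \<and> (\<Sum>e\<in>D. if e \<in> T \<or> e = a then 1 else 0 :: bit) = 0"
    (is "?L = 0 \<longleftrightarrow> ?R = 0 \<and> ?p = 0")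
proof -
  have fin: "finite D"
    using assms finite_labels finite_subset by blast
  have below: "?L i = ?R i" if "i < row_count A" for i
  proof -
    have "?L i = (\<Sum>e\<in>D. if e = a then 0 else column A e i)"
      using that by (auto simp: sum_fun_apply column_def element_splitting_matrix_def intro!: sum.cong)
    also have "\<dots> = (\<Sum>e\<in>D - {a}. column A e i)"
      using fin by (intro sum.mono_neutral_cong_right) auto
    finally show ?thesis by (simp add: sum_fun_apply)
  qed
  have last: "?L (row_count A) = ?p"
    by (auto simp: sum_fun_apply column_def element_splitting_matrix_def intro!: sum.cong)
  have above: "?L i = 0" if "i > row_count A" for i
    using that by (auto simp: sum_fun_apply column_def element_splitting_matrix_def)
  have above': "?R i = 0" if "i \<ge> row_count A" for i
    using that by (auto simp: sum_fun_apply column_def)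
  show ?thesis
    using below last above above' unfolding fun_eq_iff zero_fun_apply
    by (metis linorder_neqE_nat order.refl order.strict_implies_order)
qed

lemma indep_M_iff: "X \<in> indep M \<longleftrightarrow>
    X \<subseteq> labels A \<and> (\<forall>D\<subseteq>X. D \<noteq> {} \<longrightarrow> (\<Sum>e\<in>D. column A e) \<noteq> 0)"
  using finite_labels by (rule indep_vector_matroid_iff)

lemma indep_N_iff: "X \<in> indep N \<longleftrightarrow> X \<subseteq> insert a (labels A) \<and>
    (\<forall>D\<subseteq>X. D \<noteq> {} \<longrightarrow> (\<Sum>e\<in>D - {a}. column A e) = 0 \<longrightarrow>
      (\<Sum>e\<in>D. if e \<in> T \<or> e = a then 1 else 0 :: bit) \<noteq> 0)"
proof -
  have "labels (element_splitting_matrix A T a) = insert a (labels A)"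
    by (simp add: element_splitting_matrix_def)
  then have "X \<in> indep N \<longleftrightarrow> X \<subseteq> insert a (labels A) \<and>
    (\<forall>D\<subseteq>X. D \<noteq> {} \<longrightarrow> (\<Sum>e\<in>D. column (element_splitting_matrix A T a) e) \<noteq> 0)"
    unfolding element_splitting_def indep_vector_matroid_iff[OF finite_split_labels] by simp
  also have "\<dots> \<longleftrightarrow> X \<subseteq> insert a (labels A) \<and>
    (\<forall>D\<subseteq>X. D \<noteq> {} \<longrightarrow> (\<Sum>e\<in>D - {a}. column A e) = 0 \<longrightarrow>
      (\<Sum>e\<in>D. if e \<in> T \<or> e = a then 1 else 0 :: bit) \<noteq> 0)"
    by (intro conj_cong refl all_cong1 imp_cong) (use split_sum_eq_0_iff in blast)
  finally show ?thesis .
qed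

text \<open>With its converse below, this says that contracting \<open>a\<close> returns
  \<open>M\<close>. The old rows turn a relation on \<open>insert a I\<close> into one on
  \<open>I\<close>, leaving only \<open>{a}\<close>, whose parity is odd.\<close>

lemma indep_M_imp_indep_N_insert:
  assumes "I \<in> indep M"
  shows "insert a I \<in> indep N"
  unfolding indep_N_iff
proof (intro conjI allI impI)
  show "insert a I \<subseteq> insert a (labels A)"
    using assms by (auto simp: indep_M_iff)
  fix D assume D: "D \<subseteq> insert a I" "D \<noteq> {}" "(\<Sum>e\<in>D - {a}. column A e) = 0"
  then have "D - {a} = {}"
    using indep_vector_matroid_sum_0D[OF finite_labels assms] by blast
  then have "D = {a}" using D(2) by blast
  then show "(\<Sum>e\<in>D. if e \<in> T \<or> e = a then 1 else 0 :: bit) \<noteq> 0" by simp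
qed

lemma indep_N_insert_imp_indep_M:
  assumes "insert a I \<in> indep N" "a \<notin> I"
  shows "I \<in> indep M"
  unfolding indep_M_iff
proof (intro conjI allI impI notI)
  show "I \<subseteq> labels A"
    using assms by (auto simp: indep_N_iff)
  fix D assume D: "D \<subseteq> I" "D \<noteq> {}" "(\<Sum>e\<in>D. column A e) = 0"
  let ?p = "\<lambda>D. \<Sum>e\<in>D. if e \<in> T \<or> e = a then 1 else 0 :: bit"
  have "finite D" "a \<notin> D"
    using D(1) \<open>I \<subseteq> labels A\<close> assms(2) finite_subset[OF _ finite_labels, of D] by auto
  have nz: "?p D' \<noteq> 0" if "D' \<subseteq> insert a I" "D' \<noteq> {}" "D' - {a} = D" for D'
    using assms(1)[unfolded indep_N_iff] that D(3) by metis
  \<comment> \<open>\<open>D\<close> and \<open>insert a D\<close> have the same zero sum in the old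
    rows but opposite parities, so one of them is a relation of the splitting.\<close>
  have "?p D \<noteq> 0" "?p (insert a D) \<noteq> 0"
    by (rule nz; use D(1,2) \<open>a \<notin> D\<close> in blast)+
  moreover have "?p (insert a D) = 1 + ?p D"
    using \<open>finite D\<close> \<open>a \<notin> D\<close> by simp
  ultimately show False
    using bit_add_self[of 1] by simp
qed

lemma rank_N_insert:
  assumes "X \<subseteq> labels A"
  shows "rank_of N (insert a X) = rank_of M X + 1"
proof (rule antisym)
  obtain I where I: "I \<in> indep M" "I \<subseteq> X" "card I = rank_of M X"
    by (rule M.rank_witness)
  have "a \<notin> I" using I assms a_new by blast
  with N.card_le_rank[OF indep_M_imp_indep_N_insert[OF I(1)], of "insert a X"] I M.finite_indep
  show "rank_of M X + 1 \<le> rank_of N (insert a X)" by (auto simp: insert_mono)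
next
  \<comment> \<open>Extending from \<open>{a}\<close> yields a maximum independent set that contains
    \<open>a\<close>, so that \<open>a\<close> can be removed again.\<close>
  have "{a} \<in> indep N"
    using indep_M_imp_indep_N_insert[OF M.indep_empty] .
  then obtain J where J: "J \<in> indep N" "a \<in> J" "J \<subseteq> insert a X"
    "card J = rank_of N (insert a X)"
    using N.extend_to_rank[of "{a}" "insert a X"] by auto
  have "J - {a} \<in> indep M"
    using indep_N_insert_imp_indep_M[of "J - {a}"] J(1,2) by (simp add: insert_absorb)
  then have "card (J - {a}) \<le> rank_of M X"
    using J(3) by (intro M.card_le_rank) auto
  with J(4) card_Suc_Diff1[OF N.finite_indep[OF J(1)] J(2)]
  show "rank_of N (insert a X) \<le> rank_of M X + 1" by linarith
qed

lemma rank_M_le_rank_N: "rank_of M X \<le> rank_of N X"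
proof -
  obtain I where I: "I \<in> indep M" "I \<subseteq> X" "card I = rank_of M X"
    by (rule M.rank_witness)
  have "I \<in> indep N"
    using N.indep_mono[OF indep_M_imp_indep_N_insert[OF I(1)]] by blast
  with N.card_le_rank I show ?thesis by metis
qed

text \<open>On \<open>X\<close> the new row equals \<open>f\<close> of the old columns, so every
  relation of old columns within \<open>X\<close> also has zero sum in the new row.\<close>

lemma rank_N_eq_of_cocycle:
  assumes X: "X \<subseteq> labels A" and Z: "cocycle A Z" and disj: "X \<inter> sym_diff T Z = {}"
  shows "rank_of N X = rank_of M X"
proof (rule antisym)
  obtain f where f: "gf2_functional f" and Z: "Z = {e \<in> labels A. f (column A e) = 1}"
    using Z by (auto simp: cocycle_def)
  have fX: "f (column A e) = (if e \<in> T \<or> e = a then 1 else 0)" if "e \<in> X" for e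
    using that X disj a_new unfolding Z by auto
  obtain J where J: "J \<in> indep N" "J \<subseteq> X" "card J = rank_of N X"
    by (rule N.rank_witness)
  have "J \<in> indep M"
    unfolding indep_M_iff
  proof (intro conjI allI impI notI)
    show "J \<subseteq> labels A" using J(2) X by blast
    fix D assume D: "D \<subseteq> J" "D \<noteq> {}" "(\<Sum>e\<in>D. column A e) = 0"
    have "(\<Sum>e\<in>D. if e \<in> T \<or> e = a then 1 else 0 :: bit) = f (\<Sum>e\<in>D. column A e)"
      using fX D(1) J(2) unfolding gf2_functional_sum[OF f] by (intro sum.cong) auto
    also have "\<dots> = 0"
      using D(3) gf2_functional.linear_0[OF f] by simp
    finally have "(\<Sum>e\<in>D. if e \<in> T \<or> e = a then 1 else 0 :: bit) = 0" .
    moreover have "D - {a} = D" using D(1) J(2) X a_new by blast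
    ultimately show False
      using J(1) D unfolding indep_N_iff by metis
  qed
  then show "rank_of N X \<le> rank_of M X"
    using M.card_le_rank J(2,3) by metis
qed (rule rank_M_le_rank_N)

text \<open>A functional can match the new row on a maximum independent \<open>I\<close> in
  \<open>X\<close>. Its cocycle must disagree with \<open>T\<close> at some \<open>e\<close> in
  \<open>X\<close>, and this \<open>e\<close> enlarges \<open>I\<close> to an independent set of the
  splitting.\<close>

lemma rank_N_ge_of_no_cocycle:
  assumes X: "X \<subseteq> labels A" and no: "\<And>Z. cocycle A Z \<Longrightarrow> X \<inter> sym_diff T Z \<noteq> {}"
  shows "rank_of M X + 1 \<le> rank_of N X"
proof -
  obtain I where I: "I \<in> indep M" "I \<subseteq> X" "card I = rank_of M X"
    by (rule M.rank_witness)
  let ?t = "\<lambda>e. if e \<in> T \<or> e = a then 1 else 0 :: bit"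
  obtain f where f: "gf2_functional f" and fI: "\<And>x. x \<in> I \<Longrightarrow> f (column A x) = ?t x"
    using gf2_functional_extend_indep[OF I(1), of ?t] by blast
  have "cocycle A {e \<in> labels A. f (column A e) = 1}"
    using f by (auto simp: cocycle_def)
  from no[OF this] obtain e where e: "e \<in> X" "e \<in> T \<longleftrightarrow> f (column A e) \<noteq> 1"
    using X by blast
  have "f (column A e) \<noteq> ?t e"
    using e X a_new by auto
  with fI have "e \<notin> I" by blast
  have "insert e I \<in> indep N"
    unfolding indep_N_iff
  proof (intro conjI allI impI notI)
    show "insert e I \<subseteq> insert a (labels A)" using e I X by blast
    fix D assume D: "D \<subseteq> insert e I" "D \<noteq> {}" "(\<Sum>e\<in>D - {a}. column A e) = 0" "sum ?t D = 0"
    have Da: "D - {a} = D" using D(1) e(1) I(2) X a_new by blast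
    have finD: "finite D"
      using D(1) M.finite_indep[OF I(1)] by (meson finite.insertI finite_subset)
    have "e \<in> D"
      using indep_vector_matroid_sum_0D[OF finite_labels I(1), of D] D Da by auto
    \<comment> \<open>On a relation both \<open>f\<close> and the new row sum to 0. As they agree on
      \<open>I\<close>, only the term at \<open>e\<close> survives, and it is nonzero.\<close>
    have "(\<Sum>x\<in>D. f (column A x) + ?t x) = (\<Sum>x\<in>{e}. f (column A x) + ?t x)"
      using finD \<open>e \<in> D\<close> D(1) fI by (intro sum.mono_neutral_right) auto
    moreover have "(\<Sum>x\<in>D. f (column A x) + ?t x) = 0"
      using D(3,4) Da gf2_functional_sum[OF f, of "column A" D] gf2_functional.linear_0[OF f]
      by (simp only: sum.distrib) simp
    ultimately show False
      using \<open>f (column A e) \<noteq> ?t e\<close> by (auto split: if_splits)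
  qed
  then have "card (insert e I) \<le> rank_of N X"
    using e(1) I(2) by (intro N.card_le_rank) auto
  with \<open>e \<notin> I\<close> M.finite_indep[OF I(1)] I(3) show ?thesis by simp
qed

section \<open>Separations of the splitting matroid\<close>

lemma n_connected_splitting_iff:
  assumes conn: "n_connected n M" and large: "card (labels A) \<ge> 2 * n - 2"
  shows "n_connected n N \<longleftrightarrow> (\<forall>Z. cocycle A Z \<longrightarrow> n - 1 \<le> card (sym_diff T Z))"
proof (intro iffI allI impI)
  fix Z assume N: "n_connected n N" and Z: "cocycle A Z"
  show "n - 1 \<le> card (sym_diff T Z)"
  proof (rule ccontr)
    assume small: "\<not> n - 1 \<le> card (sym_diff T Z)"
    define Y where "Y = sym_diff T Z"
    define X where "X = labels A - Y"
    have Y: "Y \<subseteq> labels A" "card Y < n - 1" and finY: "finite Y"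
      using T_subset cocycle_subset[OF Z] small finite_subset[OF _ finite_labels, of Y]
      by (auto simp: Y_def)
    have "card X = card (labels A) - card Y"
      unfolding X_def using finY Y(1) by (rule card_Diff_subset)
    \<comment> \<open>Since \<open>Y\<close> has at most \<open>n - 2\<close> elements,
      \<open>X\<close> has at least \<open>n\<close>, enough for a separation of order
      \<open>card Y + 1\<close>.\<close>
    with large Y(2) have cardX: "card X \<ge> card Y + 1" by linarith
    have "a \<notin> Y" using Y(1) a_new by blast
    then have cardY: "card (insert a Y) = card Y + 1" using finY by simp
    have "rank_of N X = rank_of M X"
      using Z by (rule rank_N_eq_of_cocycle[rotated]) (auto simp: X_def Y_def)
    moreover have "rank_of N (insert a Y) = rank_of M Y + 1"
      using Y(1) by (rule rank_N_insert)
    moreover have "rank_of N (ground N) = rank_of M (labels A) + 1"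
      unfolding ground_N by (rule rank_N_insert) simp
    moreover have "rank_of M X \<le> rank_of M (labels A)"
      by (rule M.rank_witness[of X])
        (metis M.card_le_rank M.indep_subset ground_vector_matroid)
    moreover have "rank_of M Y \<le> card Y"
      using finY by (rule M.rank_le_card)
    \<comment> \<open>The units that \<open>a\<close> adds to the ranks of \<open>insert a Y\<close>
      and of the ground set cancel, so the connectivity is at most \<open>rank_of M Y\<close>, hence
      at most \<open>card Y\<close>.\<close>
    ultimately have "k_separation (card Y + 1) N X (insert a Y)"
      unfolding k_separation_def using cardX cardY Y(1) a_new by (auto simp: X_def ground_N)
    with N Y(2) show False by (auto simp: n_connected_def)
  qed
next
  assume dist: "\<forall>Z. cocycle A Z \<longrightarrow> n - 1 \<le> card (sym_diff T Z)"
  \<comment> \<open>The side containing \<open>a\<close> is taken to be the second one;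
    \<open>sep_commute\<close> covers the other case.\<close>
  have no_sep: False if sep: "k_separation k N X (insert a Y)" and aY: "a \<notin> Y" and k: "k < n" for k X Y
  proof -
    have XY: "X \<union> Y = labels A" "X \<inter> Y = {}" and cards: "card X \<ge> k" "card (insert a Y) \<ge> k"
      and conn_N: "int (rank_of N X) + int (rank_of N (insert a Y)) - int (rank_of N (ground N)) \<le> int k - 1"
      using sep aY a_new unfolding k_separation_def ground_N by auto
    have finXY: "finite X" "finite Y"
      using XY(1) finite_labels by (metis finite_Un)+
    have low: "int (rank_of M X) + int (rank_of M Y) - int (rank_of M (labels A)) > int j - 1"
      if "j < n" "j \<le> card X" "j \<le> card Y" for j
      using conn that XY unfolding n_connected_def k_separation_def by fastforce
    have ranks: "rank_of N (insert a Y) = rank_of M Y + 1"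
      "rank_of N (ground N) = rank_of M (labels A) + 1"
      using XY(1) rank_N_insert by (auto simp: ground_N)
    show False
    proof (cases "k \<le> card Y")
      case True
      \<comment> \<open>Here removing \<open>a\<close> would leave a \<open>k\<close>-separation of
        \<open>M\<close>, because ranks in the splitting are no smaller.\<close>
      with low[OF k cards(1)] rank_M_le_rank_N[of X] ranks conn_N show False by linarith
    next
      case False
      then have cardY: "k = card Y + 1"
        using cards(2) aY finXY(2) by simp
      have "X \<inter> sym_diff T Z \<noteq> {}" if "cocycle A Z" for Z
      proof
        assume "X \<inter> sym_diff T Z = {}"
        then have "sym_diff T Z \<subseteq> Y"
          using XY T_subset cocycle_subset[OF that] by blast
        then have "card (sym_diff T Z) \<le> card Y"
          using finXY(2) by (rule card_mono[rotated])
        moreover have "n - 1 \<le> card (sym_diff T Z)" using dist that by blast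
        ultimately show False using cardY k by linarith
      qed
      \<comment> \<open>With \<open>card Y = k - 1\<close>, connectivity of \<open>M\<close> is
        available only at order \<open>k - 1\<close>; the extra unit of rank on \<open>X\<close>
        makes up the difference.\<close>
      then have "rank_of M X + 1 \<le> rank_of N X"
        using XY(1) by (intro rank_N_ge_of_no_cocycle) auto
      with low[of "card Y"] cardY k cards(1) ranks conn_N show False by linarith
    qed
  qed
  have sep_commute: "k_separation k N Y X" if "k_separation k N X Y" for k X Y
    using that unfolding k_separation_def by (auto simp: Un_commute Int_commute)
  show "n_connected n N"
    unfolding n_connected_def
  proof (intro allI impI notI)
    fix k assume k: "k < n" and "\<exists>X Y. k_separation k N X Y"
    then obtain X Y where sep: "k_separation k N X Y" by blast
    then have "a \<in> X \<union> Y" unfolding k_separation_def ground_N by blast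
    then obtain X' Y' where sep': "k_separation k N X' Y'" "a \<in> Y'"
      using sep sep_commute by blast
    then have "k_separation k N X' (insert a (Y' - {a}))"
      by (simp add: insert_absorb)
    with k show False using no_sep by blast
  qed
qed

end

theorem mainTheorem1:
  fixes n :: nat and M :: "'a matroid" and A :: "'a gf2_matrix" and T :: "'a set" and a :: 'a
  assumes "n \<ge> 2"
    and "binary_matroid M"
    and "standard_representation A M"
    and "n_connected n M"
    and "card (ground M) \<ge> 2 * n - 2"
    and "T \<subset> ground M"
    and "card T = n - 1"
    and "a \<notin> ground M"
  shows "n_connected n (element_splitting A T a) \<longleftrightarrow>
    (\<forall>Q. cocircuit M Q \<and> Q \<inter> T \<noteq> {} \<longrightarrow> card Q \<ge> 2 * card (Q \<inter> T))"
proof -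
  have M: "M = vector_matroid A"
    using assms(3) by (simp add: standard_representation_def)
  have fin: "finite (labels A)"
    using assms(2) matroid.finite_ground[of M] by (simp add: binary_matroid_def M)
  interpret splitting A T a
    using fin assms(6,8) by unfold_locales (auto simp: M)
  have "finite T"
    using T_subset fin finite_subset by blast
  then show ?thesis
    using n_connected_splitting_iff[of n] cocircuit_bound_iff_cocycle_distance[OF fin, of T]
      assms(4,5,7) by (simp add: M)
qed

end
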